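(* Let $n = 2t+1$, and let $(S,* )$ be a Steiner loop from the Bose construction on $\mathbb{Z}_n \times \mathbb{Z}_3$. Then $S$ has the property $\mathcal{MP}$ if and only if $7$ is an invertible element in $\mathbb{Z}_n$.
   Context: A loop is a nonempty set $L$ with a binary operation having a two-sided identity element $1$ and such that left multiplication and right multiplication by any fixed element are permutations of $L$. A Steiner loop is a loop with the inverse property (there is a bijection $x \mapsto x^{-1}$ with $x^{-1}(xy) = y = (yx)x^{-1}$ for all $x,y$) and of exponent $2$. A loop is a Moufang loop if it satisfies any of the following equivalent identities: $x(y(xz)) = ((xy)x)z$, $y(x(zx)) = ((yx)z)x$, $(xy)(zx) = x((yz)x)$. The associator $(a,b,c)$ of elements $a,b,c$ of a loop $L$ is the unique element of $L$ with $(ab)c = (a(bc))\,(a,b,c)$; thus $(a,b,c)=1$ if and only if $(ab)c = a(bc)$. A loop $L$ satisfies Moufang's Property $\mathcal{MP}$ if $L$ is not a Moufang loop, but it satisfies the statement of Moufang's theorem, i.e., whenever $a,b,c \in L$ satisfy $(a,b,c) = 1$, the elements $a,b,c$ generate a subgroup of $L$. Bose construction: let $n = 2t+1$ (so that $2$ is invertible in $\mathbb{Z}_n$; $\frac{u}{2}$ denotes $2^{-1}u$ in $\mathbb{Z}_n$). Put $Q = \mathbb{Z}_n \times \mathbb{Z}_3$ and $S = Q \cup \{1\}$, where $1 \notin Q$. Define $*$ on $S$ so that $1$ is the identity element and, for $x,y \in \mathbb{Z}_n$ and $i,j,k \in \mathbb{Z}_3$ (second coordinates computed modulo $3$): \[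 \begin{array}{rcll} (x,i)*(x,j) &=& (x,k) & \text{where } i \neq j,\ i\neq k,\ j \neq k,\\ (x,i)*(y,i) &=& \left(\frac{x+y}{2},\, i+1\right) & \text{if } x \neq y,\\ (x,i)*(y,i+1) &=& (2y-x,\, i) & \text{if } x \neq y,\\ (x,i)*(y,i-1) &=& (2x-y,\, i-1) & \text{if } x \neq y,\\ (x,i)*(x,i) &=& 1. & \end{array} \] Then $(S,* )$ is a commutative loop; it is the Steiner loop corresponding to the Steiner triple system on $Q$ whose triples are $\{(x,0),(x,1),(x,2)\}$ for $x \in \mathbb{Z}_n$, and $\{(x,i),(y,i),(\frac{x+y}{2},i+1)\}$ for $x \neq y$ in $\mathbb{Z}_n$ and $i \in \mathbb{Z}_3$.
   Formalization: The case t = 0 (n = 1) is excluded: there S is the Klein four-group, which is Moufang and so lacks MP, although 7 is invertible in the zero ring Z_1, so the claim fails as written. *)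

theory Defs
  imports "HOL-Number_Theory.Residues"
begin

text \<open>
  Loops are represented by the \<^type>\<open>monoid_ext\<close> records of HOL-Algebra (a carrier, a
  multiplication and an identity element); associativity is not assumed.
\<close>

locale loop =
  fixes L :: "('a, 'b) monoid_scheme" (structure)
  assumes m_closed: "\<lbrakk>x \<in> carrier L; y \<in> carrier L\<rbrakk> \<Longrightarrow> x \<otimes> y \<in> carrier L"
    and one_closed: "\<one> \<in> carrier L"
    and l_one: "x \<in> carrier L \<Longrightarrow> \<one> \<otimes> x = x"
    and r_one: "x \<in> carrier L \<Longrightarrow> x \<otimes> \<one> = x"
    and left_perm: "a \<in> carrier L \<Longrightarrow> bij_betw (\<lambda>x. a \<otimes> x) (carrier L) (carrier L)"
    and right_perm: "a \<in> carrier L \<Longrightarrow> bij_betw (\<lambda>x. x \<otimes> a) (carrier L) (carrier L)"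

locale moufang_loop = loop +
  assumes moufang: "\<lbrakk>x \<in> carrier L; y \<in> carrier L; z \<in> carrier L\<rbrakk>
    \<Longrightarrow> x \<otimes> (y \<otimes> (x \<otimes> z)) = ((x \<otimes> y) \<otimes> x) \<otimes> z"

definition associator :: "('a, 'b) monoid_scheme \<Rightarrow> 'a \<Rightarrow> 'a \<Rightarrow> 'a \<Rightarrow> 'a" where
  "associator L a b c =
     (THE d. d \<in> carrier L \<and>
        (a \<otimes>\<^bsub>L\<^esub> b) \<otimes>\<^bsub>L\<^esub> c = (a \<otimes>\<^bsub>L\<^esub> (b \<otimes>\<^bsub>L\<^esub> c)) \<otimes>\<^bsub>L\<^esub> d)"

definition subloop :: "'a set \<Rightarrow> ('a, 'b) monoid_scheme \<Rightarrow> bool" where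
  "subloop H L \<longleftrightarrow> H \<subseteq> carrier L \<and> loop (L\<lparr>carrier := H\<rparr>)"

definition loop_generate :: "('a, 'b) monoid_scheme \<Rightarrow> 'a set \<Rightarrow> 'a set" where
  "loop_generate L A = \<Inter>{H. subloop H L \<and> A \<subseteq> H}"

definition moufang_property :: "('a, 'b) monoid_scheme \<Rightarrow> bool" where
  "moufang_property L \<longleftrightarrow>
     loop L \<and> \<not> moufang_loop L \<and>
     (\<forall>a\<in>carrier L. \<forall>b\<in>carrier L. \<forall>c\<in>carrier L.
        associator L a b c = \<one>\<^bsub>L\<^esub> \<longrightarrow> group (L\<lparr>carrier := loop_generate L {a, b, c}\<rparr>))"

text \<open>
  The product of two points of \<open>Q = \<int>\<^sub>n \<times> \<int>\<^sub>3\<close> in the Bose construction, where residue classes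
  are the elements of the carriers of \<^const>\<open>residue_ring\<close>. The value \<^const>\<open>None\<close> stands
  for the adjoined identity element, and \<^term>\<open>Some p\<close> for the point \<^term>\<open>p\<close>.
  The last case is \<open>j = i - 1\<close>.
\<close>

definition bose_point_mult :: "nat \<Rightarrow> int \<times> int \<Rightarrow> int \<times> int \<Rightarrow> (int \<times> int) option" where
  "bose_point_mult n p q =
     (let Z = residue_ring (int n); T = residue_ring 3;
          (x, i) = p; (y, j) = q
      in if x = y then
           (if i = j then None
            else Some (x, THE k. k \<in> carrier T \<and> k \<noteq> i \<and> k \<noteq> j))
         else if j = i then
           Some (inv\<^bsub>Z\<^esub> 2 \<otimes>\<^bsub>Z\<^esub> (x \<oplus>\<^bsub>Z\<^esub> y), i \<oplus>\<^bsub>T\<^esub> 1)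
         else if j = i \<oplus>\<^bsub>T\<^esub> 1 then
           Some ((2 \<otimes>\<^bsub>Z\<^esub> y) \<ominus>\<^bsub>Z\<^esub> x, i)
         else
           Some ((2 \<otimes>\<^bsub>Z\<^esub> x) \<ominus>\<^bsub>Z\<^esub> y, i \<ominus>\<^bsub>T\<^esub> 1))"

fun bose_mult :: "nat \<Rightarrow> (int \<times> int) option \<Rightarrow> (int \<times> int) option \<Rightarrow> (int \<times> int) option" where
  "bose_mult n None q = q"
| "bose_mult n (Some p) None = Some p"
| "bose_mult n (Some p) (Some q) = bose_point_mult n p q"

definition bose_loop :: "nat \<Rightarrow> (int \<times> int) option monoid" where
  "bose_loop n =
     \<lparr>carrier = insert None
        (Some ` (carrier (residue_ring (int n)) \<times> carrier (residue_ring 3))),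
      monoid.mult = bose_mult n,
      monoid.one = None\<rparr>"

end

theory Submission
  imports Defs
begin

text \<open>
  In a Steiner loop two elements always generate a group, and for distinct non-identity elements
  with \<open>c \<noteq> ab\<close> the equation \<open>(ab)c = a(bc)\<close> says that \<open>a, b, c, ab, bc\<close> and \<open>(ab)c\<close> form a Pasch
  configuration: four blocks on six points, any two blocks meeting in one point. In the Bose
  triple system at most one block of a Pasch configuration is vertical. If none is, the second
  coordinates force the upper points to coincide in pairs, and two of the six points coincide.
  If one is, the second coordinates leave only the system \<open>u = 2v\<close>, \<open>v = 2w\<close>, \<open>w = 2u\<close>
  (relative to the vertical block), that is \<open>7u = 0\<close>. So there is no Pasch
  configuration if 7 is invertible. Otherwise 7 divides \<open>n\<close>, the system has a nonzero solution, and
  the resulting associating triple generates a subloop that is not associative.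
\<close>

section \<open>Associators in loops\<close>

context loop
begin

lemma left_cancel:
  assumes "a \<in> carrier L" "x \<in> carrier L" "y \<in> carrier L" "a \<otimes> x = a \<otimes> y"
  shows "x = y"
  using left_perm[OF assms(1)] assms by (auto simp: bij_betw_def inj_on_def)

text \<open>Left multiplication by \<open>?v\<close> is a permutation, so the definite description
  in \<open>associator\<close> denotes exactly one element. Comparing it with the identity is then
  cancellation of \<open>?v\<close>.\<close>

lemma associator_eq_one_iff:
  assumes a: "a \<in> carrier L" and b: "b \<in> carrier L" and c: "c \<in> carrier L"
  shows "associator L a b c = \<one> \<longleftrightarrow> (a \<otimes> b) \<otimes> c = a \<otimes> (b \<otimes> c)"
proof -
  let ?u = "(a \<otimes> b) \<otimes> c" and ?v = "a \<otimes> (b \<otimes> c)"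
  have u: "?u \<in> carrier L" and v: "?v \<in> carrier L"
    using assms m_closed by auto
  have "?u \<in> (\<lambda>x. ?v \<otimes> x) ` carrier L"
    using left_perm[OF v] u by (simp add: bij_betw_def)
  then obtain d where d: "d \<in> carrier L" "?u = ?v \<otimes> d"
    by auto
  have "associator L a b c = d"
    unfolding associator_def
  proof (rule the_equality)
    show "d \<in> carrier L \<and> ?u = ?v \<otimes> d"
      using d by blast
    show "e = d" if "e \<in> carrier L \<and> ?u = ?v \<otimes> e" for e
      using that d left_cancel[OF v, of e d] by metis
  qed
  then show ?thesis
    using d r_one[OF v] left_cancel[OF v d(1) one_closed] by metis
qed

end

section \<open>Steiner loops, their subloops and generated groups\<close>

text \<open>An equational form of the inverse property and exponent 2, each element being its own
  inverse. Apart from the two closure conditions the axioms are identities, so they pass to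
  subsets.\<close>

locale steiner_loop =
  fixes L :: "('a, 'b) monoid_scheme" (structure)
  assumes closed: "\<lbrakk>x \<in> carrier L; y \<in> carrier L\<rbrakk> \<Longrightarrow> x \<otimes> y \<in> carrier L"
    and one_in: "\<one> \<in> carrier L"
    and one_mult: "x \<in> carrier L \<Longrightarrow> \<one> \<otimes> x = x"
    and comm: "\<lbrakk>x \<in> carrier L; y \<in> carrier L\<rbrakk> \<Longrightarrow> x \<otimes> y = y \<otimes> x"
    and mult_mult: "\<lbrakk>x \<in> carrier L; y \<in> carrier L\<rbrakk> \<Longrightarrow> x \<otimes> (x \<otimes> y) = y"
begin

lemma mult_one: "x \<in> carrier L \<Longrightarrow> x \<otimes> \<one> = x"
  using comm[OF _ one_in] one_mult by simp

lemma square: "x \<in> carrier L \<Longrightarrow> x \<otimes> x = \<one>"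
  using mult_mult[OF _ one_in] mult_one by simp

lemma steiner_subset:
  assumes "H \<subseteq> carrier L" "\<one> \<in> H" "\<And>x y. x \<in> H \<Longrightarrow> y \<in> H \<Longrightarrow> x \<otimes> y \<in> H"
  shows "steiner_loop (L\<lparr>carrier := H\<rparr>)"
  using assms by unfold_locales (auto intro: one_mult comm mult_mult)

lemma loop: "loop L"
proof -
  have l: "bij_betw (\<lambda>x. a \<otimes> x) (carrier L) (carrier L)" if a: "a \<in> carrier L" for a
    by (rule bij_betwI[where g = "\<lambda>x. a \<otimes> x"]) (auto simp: a closed mult_mult)
  have r: "bij_betw (\<lambda>x. x \<otimes> a) (carrier L) (carrier L)" if a: "a \<in> carrier L" for a
    using l[OF a] comm[OF a] by (subst bij_betw_cong) auto
  show ?thesis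
    using l r by unfold_locales (auto simp: closed one_in one_mult mult_one)
qed

text \<open>Division in a Steiner loop is multiplication, so a subset closed under the product
  automatically has bijective translations.\<close>

lemma subloop_iff:
  "subloop H L \<longleftrightarrow> H \<subseteq> carrier L \<and> \<one> \<in> H \<and> (\<forall>x\<in>H. \<forall>y\<in>H. x \<otimes> y \<in> H)"
proof
  assume "subloop H L"
  then have H: "H \<subseteq> carrier L" and "loop (L\<lparr>carrier := H\<rparr>)"
    by (auto simp: subloop_def)
  then interpret H: loop "L\<lparr>carrier := H\<rparr>"
    by simp
  show "H \<subseteq> carrier L \<and> \<one> \<in> H \<and> (\<forall>x\<in>H. \<forall>y\<in>H. x \<otimes> y \<in> H)"
    using H H.one_closed H.m_closed by simp
next
  assume "H \<subseteq> carrier L \<and> \<one> \<in> H \<and> (\<forall>x\<in>H. \<forall>y\<in>H. x \<otimes> y \<in> H)"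
  then show "subloop H L"
    unfolding subloop_def using steiner_loop.loop[OF steiner_subset] by blast
qed

lemma subloop_carrier: "subloop (carrier L) L"
  by (simp add: subloop_iff one_in closed)

text \<open>The carrier is itself one of the intersected subloops, so the intersection stays inside
  it; the closure conditions pass to intersections.\<close>

lemma subloop_generate:
  assumes "A \<subseteq> carrier L"
  shows "subloop (loop_generate L A) L"
  unfolding subloop_iff loop_generate_def
  using subloop_carrier assms by (auto simp: subloop_iff)

lemma generate_subset: "A \<subseteq> loop_generate L A"
  unfolding loop_generate_def by blast

text \<open>Associativity may be checked on any convenient subloop around the generators, without
  computing the generated one. Inverses come for free from \<open>square\<close>.\<close>

lemma group_generate:
  assumes H: "subloop H L" "A \<subseteq> H"
    and assoc: "\<And>x y z. \<lbrakk>x \<in> H; y \<in> H; z \<in> H\<rbrakk> \<Longrightarrow> (x \<otimes> y) \<otimes> z = x \<otimes> (y \<otimes> z)"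
  shows "group (L\<lparr>carrier := loop_generate L A\<rparr>)"
proof -
  let ?G = "loop_generate L A"
  have "subloop ?G L"
    using subloop_generate H by (auto simp: subloop_iff)
  moreover have "?G \<subseteq> H"
    using H by (auto simp: loop_generate_def)
  ultimately show ?thesis
    by (intro groupI) (auto simp: subloop_iff one_mult intro!: assoc square bexI)
qed

text \<open>The four elements multiply as in the Klein four-group. The table stays valid when some
  of them coincide, so degenerate choices of \<open>p\<close> and \<open>q\<close> need no separate
  treatment.\<close>

lemma group_generate_diassociative:
  assumes p: "p \<in> carrier L" and q: "q \<in> carrier L"
    and A: "A \<subseteq> {\<one>, p, q, p \<otimes> q}"
  shows "group (L\<lparr>carrier := loop_generate L A\<rparr>)"
proof -
  let ?r = "p \<otimes> q"
  have r: "?r \<in> carrier L"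
    using p q closed by simp
  have table: "\<one> \<otimes> \<one> = \<one>" "\<one> \<otimes> p = p" "\<one> \<otimes> q = q" "\<one> \<otimes> ?r = ?r"
    "p \<otimes> \<one> = p" "q \<otimes> \<one> = q" "?r \<otimes> \<one> = ?r"
    "p \<otimes> p = \<one>" "q \<otimes> q = \<one>" "?r \<otimes> ?r = \<one>"
    "q \<otimes> p = ?r" "p \<otimes> ?r = q" "?r \<otimes> p = q" "q \<otimes> ?r = p" "?r \<otimes> q = p"
    using p q r comm mult_mult square one_mult mult_one one_in by metis+
  show ?thesis
  proof (rule group_generate[OF _ A])
    show "subloop {\<one>, p, q, ?r} L"
      unfolding subloop_iff using p q r one_in table by auto
    show "(x \<otimes> y) \<otimes> z = x \<otimes> (y \<otimes> z)"
      if "x \<in> {\<one>, p, q, ?r}" "y \<in> {\<one>, p, q, ?r}" "z \<in> {\<one>, p, q, ?r}" for x y z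
      using that by (elim insertE emptyE) (simp_all add: table)
  qed
qed

end

section \<open>The Bose triple system and its Pasch configurations\<close>

text \<open>The triples \<open>{(x,i), (y,i), ((x+y)/2, i+1)}\<close>, with \<open>r\<close> the point on the upper level.\<close>
definition slanted :: "nat \<Rightarrow> int \<times> int \<Rightarrow> int \<times> int \<Rightarrow> int \<times> int \<Rightarrow> bool" where
  "slanted n p q r \<longleftrightarrow> fst p \<noteq> fst q \<and> snd q = snd p \<and> snd r = (snd p + 1) mod 3 \<and>
     [fst p + fst q = 2 * fst r] (mod int n)"

definition vertical :: "int \<times> int \<Rightarrow> int \<times> int \<Rightarrow> int \<times> int \<Rightarrow> bool" where
  "vertical p q r \<longleftrightarrow> fst p = fst q \<and> fst q = fst r \<and>
     snd p \<noteq> snd q \<and> snd q \<noteq> snd r \<and> snd p \<noteq> snd r"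

text \<open>Since \<open>slanted\<close> is symmetric in its first two arguments, the three
  rotations account for all orders of the points of a slanted triple.\<close>

definition block :: "nat \<Rightarrow> int \<times> int \<Rightarrow> int \<times> int \<Rightarrow> int \<times> int \<Rightarrow> bool" where
  "block n p q r \<longleftrightarrow> vertical p q r \<or> slanted n p q r \<or> slanted n q r p \<or> slanted n r p q"

definition points :: "nat \<Rightarrow> (int \<times> int) set" where
  "points n = {0..<int n} \<times> {0, 1, 2}"

lemma fst_points: "p \<in> points n \<Longrightarrow> 0 \<le> fst p \<and> fst p < int n"
  by (auto simp: points_def)

lemma snd_points: "p \<in> points n \<Longrightarrow> snd p = 0 \<or> snd p = 1 \<or> snd p = 2"
  by (auto simp: points_def)

lemma slanted_commute: "slanted n p q r \<longleftrightarrow> slanted n q p r"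
  by (auto simp: slanted_def add.commute)

lemma block_commute: "block n p q r \<longleftrightarrow> block n q p r"
  using slanted_commute unfolding block_def vertical_def by metis

lemma block_rotate: "block n p q r \<longleftrightarrow> block n q r p"
  unfolding block_def vertical_def by metis

lemma cong_eq:
  fixes x y :: int
  assumes "[x = y] (mod int n)" "0 \<le> x" "x < int n" "0 \<le> y" "y < int n"
  shows "x = y"
  using assms by (simp add: cong_def)

text \<open>The congruences of the three slanted blocks of a Pasch configuration whose fourth block is the
  vertical one over \<open>x\<close>.\<close>
lemma coprime_7_cong:
  fixes x u v w :: int
  assumes "coprime 7 m" "[x + u = 2 * v] (mod m)" "[x + v = 2 * w] (mod m)" "[x + w = 2 * u] (mod m)"
  shows "[u = x] (mod m)"
proof -
  \<comment> \<open>The weights 1, 2, 4 make \<open>v\<close> and \<open>w\<close> cancel along the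
    cycle.\<close>
  have "m dvd (x + u - 2 * v) + 2 * (x + v - 2 * w) + 4 * (x + w - 2 * u)"
    using assms by (intro dvd_add dvd_mult) (auto simp: cong_iff_dvd_diff)
  then have "m dvd 7 * (x - u)"
    by (simp add: algebra_simps)
  then have "m dvd x - u"
    using assms(1) coprime_dvd_mult_right_iff[of m 7] coprime_commute[of m 7] by blast
  then show ?thesis
    by (simp add: cong_iff_dvd_diff dvd_diff_commute)
qed

text \<open>Equal midpoints give \<open>a + b = c + d\<close> and \<open>a + c = b + d\<close>; the
  difference is \<open>2 * (b - c) = 0\<close>, and 2 cancels modulo an odd number.\<close>

lemma double_cong:
  fixes a b c d u v :: int
  assumes "odd m" "[a + b = 2 * u] (mod m)" "[c + d = 2 * u] (mod m)"
    "[a + c = 2 * v] (mod m)" "[b + d = 2 * v] (mod m)"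
  shows "[b = c] (mod m)"
proof -
  have "m dvd ((a + b - 2 * u) - (c + d - 2 * u)) - ((a + c - 2 * v) - (b + d - 2 * v))"
    using assms by (intro dvd_diff[OF dvd_diff dvd_diff]) (simp_all only: cong_iff_dvd_diff)
  then have "m dvd 2 * (b - c)"
    by (simp add: algebra_simps)
  then have "m dvd b - c"
    using assms(1) coprime_dvd_mult_right_iff[of m 2] coprime_right_2_iff_odd[of m] by blast
  then show ?thesis
    by (simp add: cong_iff_dvd_diff)
qed

text \<open>Turns the cyclic level condition into explicit numerals, so that the level analysis of a
  Pasch configuration becomes a finite check.\<close>

lemma slanted_levels:
  assumes "slanted n p q r \<or> slanted n q r p \<or> slanted n r p q"
    and "p \<in> points n" "q \<in> points n" "r \<in> points n"
  defines "S \<equiv> \<lambda>p q r. slanted n p q r \<and> (snd p = 0 \<and> snd q = 0 \<and> snd r = 1 \<or>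
    snd p = 1 \<and> snd q = 1 \<and> snd r = 2 \<or> snd p = 2 \<and> snd q = 2 \<and> snd r = 0)"
  shows "S p q r \<or> S q r p \<or> S r p q"
proof -
  have "S p q r" if "slanted n p q r" "p \<in> points n" for p q r
    using that snd_points[of p n] by (auto simp: S_def slanted_def)
  then show ?thesis
    using assms(1-4) by blast
qed

lemma no_vertical_pasch:
  assumes "coprime 7 (int n)" and P: "{a, b, c, d, e, f} \<subseteq> points n"
    and D: "distinct [a, b, c, d, e, f]"
    and abd: "vertical a b d" and bce: "block n b c e" and dcf: "block n d c f" and aef: "block n a e f"
  shows False
proof -
  obtain x i where a: "a = (x, i)"
    by (cases a)
  obtain y j where b: "b = (y, j)"
    by (cases b)
  obtain z k where d: "d = (z, k)"
    by (cases d)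
  have "y = x" "z = x"
    using abd by (simp_all add: vertical_def a b d)
  note abd' = a b[unfolded \<open>y = x\<close>] d[unfolded \<open>z = x\<close>]
  have in_points: "a \<in> points n" "b \<in> points n" "c \<in> points n" "d \<in> points n" "e \<in> points n" "f \<in> points n"
    using P by simp_all
  have ijk: "(i, j, k) \<in> {(0,1,2), (0,2,1), (1,0,2), (1,2,0), (2,0,1), (2,1,0)}"
    using snd_points[of a n] snd_points[of b n] snd_points[of d n] in_points abd
    unfolding abd' vertical_def by auto
  \<comment> \<open>The vertical block uses up all three points over \<open>x\<close>. Hence the
    other three blocks, each having a point off this fibre, are slanted.\<close>
  have ne: "fst c \<noteq> x" "fst e \<noteq> x" "fst f \<noteq> x"
  proof -
    have "fst p \<noteq> x" if "p \<in> points n" "p \<noteq> a" "p \<noteq> b" "p \<noteq> d" for p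
      using that ijk by (cases p) (auto simp: abd' points_def)
    from this[of c] this[of e] this[of f] show "fst c \<noteq> x" "fst e \<noteq> x" "fst f \<noteq> x"
      using P D by auto
  qed
  let ?C = "\<lambda>u v. [x + fst u = 2 * fst v] (mod int n)"
  have "slanted n b c e \<or> slanted n c e b \<or> slanted n e b c"
    using bce ne(1) unfolding block_def vertical_def abd' by simp
  note 1 = slanted_levels[OF this in_points(2,3,5)]
  have "slanted n a e f \<or> slanted n e f a \<or> slanted n f a e"
    using aef ne(2) unfolding block_def vertical_def abd' by simp
  note 2 = slanted_levels[OF this in_points(1,5,6)]
  have "slanted n d c f \<or> slanted n c f d \<or> slanted n f d c"
    using dcf ne(1) unfolding block_def vertical_def abd' by simp
  note 3 = slanted_levels[OF this in_points(4,3,6)]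
  have 0: "snd a = 0 \<and> snd b = 1 \<and> snd d = 2 \<or> snd a = 0 \<and> snd b = 2 \<and> snd d = 1 \<or>
    snd a = 1 \<and> snd b = 0 \<and> snd d = 2 \<or> snd a = 1 \<and> snd b = 2 \<and> snd d = 0 \<or>
    snd a = 2 \<and> snd b = 0 \<and> snd d = 1 \<or> snd a = 2 \<and> snd b = 1 \<and> snd d = 0"
    using ijk by (auto simp: abd')
  \<comment> \<open>Given the levels of \<open>a\<close>, \<open>b\<close>, \<open>d\<close>, only
    two patterns survive: each of \<open>c\<close>, \<open>e\<close>, \<open>f\<close> is the upper
    point of one block, in one of the two cyclic orders.\<close>
  have "slanted n b c e \<and> slanted n a e f \<and> slanted n f d c \<or>
    slanted n e b c \<and> slanted n d c f \<and> slanted n f a e"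
    by (insert 0, elim disjE conjE, insert 1 2 3, simp_all) (elim disjE conjE; simp)+
  then have "?C c e \<and> ?C e f \<and> ?C f c \<or> ?C e c \<and> ?C c f \<and> ?C f e"
    unfolding slanted_def abd' fst_conv by (simp only: add.commute) blast
  then have "[fst c = x] (mod int n) \<or> [fst e = x] (mod int n)"
    using coprime_7_cong[OF assms(1), of x "fst c" "fst e" "fst f"]
      coprime_7_cong[OF assms(1), of x "fst e" "fst c" "fst f"] by blast
  moreover have "0 \<le> x" "x < int n" "0 \<le> fst c" "fst c < int n" "0 \<le> fst e" "fst e < int n"
    using P fst_points[of a n] fst_points[of c n] fst_points[of e n] by (simp_all add: abd')
  ultimately show False
    using cong_eq[of "fst c" x n] cong_eq[of "fst e" x n] ne by blast
qed

text \<open>The levels alone force the upper points of the four blocks to coincide in pairs.\<close>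
lemma slanted_pasch_cases:
  assumes P: "{a, b, c, d, e, f} \<subseteq> points n"
    and "slanted n a b d \<or> slanted n b d a \<or> slanted n d a b"
    and "slanted n b c e \<or> slanted n c e b \<or> slanted n e b c"
    and "slanted n d c f \<or> slanted n c f d \<or> slanted n f d c"
    and "slanted n a e f \<or> slanted n e f a \<or> slanted n f a e"
  obtains "slanted n b d a" "slanted n e f a" "slanted n e b c" "slanted n f d c"
    | "slanted n d a b" "slanted n c e b" "slanted n d c f" "slanted n a e f"
    | "slanted n a b d" "slanted n c f d" "slanted n b c e" "slanted n f a e"
proof -
  have in_points: "a \<in> points n" "b \<in> points n" "c \<in> points n" "d \<in> points n" "e \<in> points n" "f \<in> points n"
    using P by simp_all
  note 1 = slanted_levels[OF assms(2) in_points(1,2,4)]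
  note 2 = slanted_levels[OF assms(3) in_points(2,3,5)]
  note 3 = slanted_levels[OF assms(5) in_points(1,5,6)]
  note 4 = slanted_levels[OF assms(4) in_points(4,3,6)]
  have "slanted n b d a \<and> slanted n e f a \<and> slanted n e b c \<and> slanted n f d c \<or>
    slanted n d a b \<and> slanted n c e b \<and> slanted n d c f \<and> slanted n a e f \<or>
    slanted n a b d \<and> slanted n c f d \<and> slanted n b c e \<and> slanted n f a e"
    by (insert 1, elim disjE conjE, insert 2 3 4, simp_all) (elim disjE conjE; simp)+
  then show thesis
    using that by blast
qed

lemma no_slanted_pasch:
  assumes "odd n" and P: "{a, b, c, d, e, f} \<subseteq> points n" and D: "distinct [a, b, c, d, e, f]"
    and abd: "slanted n a b d \<or> slanted n b d a \<or> slanted n d a b"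
    and bce: "slanted n b c e \<or> slanted n c e b \<or> slanted n e b c"
    and dcf: "slanted n d c f \<or> slanted n c f d \<or> slanted n f d c"
    and aef: "slanted n a e f \<or> slanted n e f a \<or> slanted n f a e"
  shows False
proof -
  \<comment> \<open>Two upper points \<open>u\<close> and \<open>v\<close> split the same four
    points into pairs in two ways. Then \<open>double_cong\<close> identifies the first coordinates
    of \<open>q\<close> and \<open>r\<close>, and both lie on the level of \<open>p\<close>.\<close>
  have eq: "q = r" if "slanted n p q u" "slanted n s r u" "slanted n p r v" "slanted n s q v"
    "q \<in> points n" "r \<in> points n" for p q r s u v
  proof -
    have 1: "[fst p + fst q = 2 * fst u] (mod int n)"
      using that(1) by (simp add: slanted_def)
    have 2: "[fst r + fst s = 2 * fst u] (mod int n)"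
      using that(2) by (simp add: slanted_def add.commute)
    have 3: "[fst p + fst r = 2 * fst v] (mod int n)"
      using that(3) by (simp add: slanted_def)
    have 4: "[fst q + fst s = 2 * fst v] (mod int n)"
      using that(4) by (simp add: slanted_def add.commute)
    have "odd (int n)"
      using assms(1) by simp
    from double_cong[OF this 1 2 3 4] have "[fst q = fst r] (mod int n)" .
    then have "fst q = fst r"
      using cong_eq fst_points[OF that(5)] fst_points[OF that(6)] by blast
    moreover have "snd q = snd r"
      using that(1,3) by (simp add: slanted_def)
    ultimately show ?thesis
      by (rule prod_eqI)
  qed
  show False
    using P abd bce dcf aef
  proof (rule slanted_pasch_cases)
    assume "slanted n b d a" "slanted n e f a" "slanted n e b c" "slanted n f d c"
    then show False
      using eq[of b d a f e c] slanted_commute D P by simp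
  next
    assume "slanted n d a b" "slanted n c e b" "slanted n d c f" "slanted n a e f"
    then show False
      using eq[of a d b c e f] slanted_commute D P by simp
  next
    assume "slanted n a b d" "slanted n c f d" "slanted n b c e" "slanted n f a e"
    then show False
      using eq[of a b d c f e] slanted_commute D P by simp
  qed
qed

text \<open>By the symmetry of the configuration, relabelling lets each of the four blocks play the
  part of the vertical one.\<close>

lemma no_pasch:
  assumes "odd n" "coprime 7 (int n)" "{a, b, c, d, e, f} \<subseteq> points n" "distinct [a, b, c, d, e, f]"
    and B: "block n a b d" "block n b c e" "block n d c f" "block n a e f"
  shows False
proof -
  have S: "block n p q r = block n q p r" "block n p q r = block n p r q" for p q r
    using block_commute block_rotate by metis+
  have "\<not> vertical a b d"
    using no_vertical_pasch[of n a b c d e f] assms by blast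
  moreover have "\<not> vertical b c e"
    using no_vertical_pasch[of n b c f e d a] assms S by auto
  moreover have "\<not> vertical d c f"
    using no_vertical_pasch[of n d c e f b a] assms S by auto
  moreover have "\<not> vertical a e f"
    using no_vertical_pasch[of n a e c f b d] assms S by auto
  ultimately show False
    using no_slanted_pasch[of n a b c d e f] assms by (auto simp: block_def)
qed

section \<open>The Bose loop as a Steiner loop\<close>

text \<open>The bound on \<open>t\<close> excludes \<open>n = 1\<close>, where a single vertical
  triple yields the Klein four-group, which is Moufang.\<close>

locale bose =
  fixes n t :: nat
  assumes n: "n = 2 * t + 1" and t: "t \<ge> 1"
begin

lemma residues: "residues (int n)"
  using n t by unfold_locales simp

sublocale Z: residues "int n" "residue_ring (int n)"
  using residues by simp_all

lemma odd_n: "odd n"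
  using n by simp

lemma inv_2: "inv\<^bsub>residue_ring (int n)\<^esub> 2 = int t + 1"
proof (rule Z.comm_inv_char)
  show "2 \<in> carrier (residue_ring (int n))" "int t + 1 \<in> carrier (residue_ring (int n))"
    using n t by (auto simp: residue_ring_def)
  have "2 * (int t + 1) mod int n = (1 + 1 * int n) mod int n"
    using n by (simp add: algebra_simps)
  also have "\<dots> = 1"
    using n t by (subst mod_mult_self1) simp
  finally show "2 \<otimes>\<^bsub>residue_ring (int n)\<^esub> (int t + 1) = \<one>\<^bsub>residue_ring (int n)\<^esub>"
    by (simp add: residue_ring_def)
qed

text \<open>Replaces ring operations by integer arithmetic. The third level is
  \<open>3 - i - j\<close> because the levels sum to 3, and in the last case \<open>i - 1\<close> is
  simply \<open>j\<close>.\<close>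

lemma bose_point_mult_eq:
  assumes "(x, i) \<in> points n" "(y, j) \<in> points n"
  shows "bose_point_mult n (x, i) (y, j) =
    (if x = y then (if i = j then None else Some (x, 3 - i - j))
     else if j = i then Some ((int t + 1) * (x + y) mod int n, (i + 1) mod 3)
     else if j = (i + 1) mod 3 then Some ((2 * y - x) mod int n, i)
     else Some ((2 * x - y) mod int n, j))"
proof -
  interpret T: residues 3 "residue_ring 3"
    by unfold_locales simp_all
  have ij: "i \<in> {0, 1, 2}" "j \<in> {0, 1, 2}"
    using assms by (auto simp: points_def)
  have "(THE k. k \<in> carrier (residue_ring 3) \<and> k \<noteq> i \<and> k \<noteq> j) = 3 - i - j" if "i \<noteq> j"
    using ij that by (intro the_equality) (auto simp: residue_ring_def)
  moreover have "i \<ominus>\<^bsub>residue_ring 3\<^esub> 1 = j" if "j \<noteq> i" "j \<noteq> (i + 1) mod 3"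
    using ij that by (auto simp: a_minus_def T.res_neg_eq T.res_add_eq)
  ultimately show ?thesis
    unfolding bose_point_mult_def Let_def inv_2
    by (auto simp: a_minus_def Z.res_neg_eq Z.res_add_eq Z.res_mult_eq T.res_add_eq mod_simps)
qed

text \<open>Doubling is reversible modulo the odd number \<open>n\<close>, and
  \<open>2 * (t + 1) = n + 1\<close> acts as 1.\<close>

lemma midpoint_iff:
  assumes "0 \<le> z" "z < int n"
  shows "(int t + 1) * s mod int n = z \<longleftrightarrow> [s = 2 * z] (mod int n)"
proof -
  have "(int t + 1) * s mod int n = z \<longleftrightarrow> [(int t + 1) * s = z] (mod int n)"
    using assms by (simp add: cong_def)
  also have "\<dots> \<longleftrightarrow> int n dvd 2 * ((int t + 1) * s - z)"
    using odd_n coprime_dvd_mult_right_iff[of "int n" 2 "(int t + 1) * s - z"]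
    by (simp only: cong_iff_dvd_diff coprime_right_2_iff_odd even_of_nat_iff simp_thms)
  also have "2 * ((int t + 1) * s - z) = (s - 2 * z) + int n * s"
    using n by (simp add: algebra_simps)
  also have "int n dvd \<dots> \<longleftrightarrow> [s = 2 * z] (mod int n)"
    unfolding cong_iff_dvd_diff by (rule dvd_add_left_iff) simp
  finally show ?thesis .
qed

lemma reflect_iff:
  assumes "0 \<le> z" "z < int n"
  shows "(2 * y - x) mod int n = z \<longleftrightarrow> [z + x = 2 * y] (mod int n)"
proof -
  have "(2 * y - x) mod int n = z \<longleftrightarrow> [z = 2 * y - x] (mod int n)"
    using assms by (auto simp: cong_def)
  also have "\<dots> \<longleftrightarrow> [z + x = 2 * y] (mod int n)"
    by (simp add: cong_iff_dvd_diff algebra_simps)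
  finally show ?thesis .
qed

text \<open>\<open>slanted\<close> demands that the two lower points differ, while the product
  compares its factors, one of which may be the upper point; this converts one condition into the
  other.\<close>

lemma midpoint_distinct:
  assumes "[x + y = 2 * z] (mod int n)" "0 \<le> x" "x < int n" "0 \<le> y" "y < int n" "0 \<le> z" "z < int n"
  shows "x = y \<longleftrightarrow> y = z"
proof
  assume "x = y"
  then have "(int t + 1) * (2 * y) mod int n = z"
    using assms midpoint_iff[of z "x + y"] by simp
  moreover have "(int t + 1) * (2 * y) mod int n = y"
    using assms midpoint_iff[of y "2 * y"] by simp
  ultimately show "y = z"
    by simp
next
  assume "y = z"
  then have "[x = y] (mod int n)"
    using assms(1) by (simp add: cong_iff_dvd_diff)
  then show "x = y"
    using assms cong_eq by blast
qed

text \<open>The bridge to the triple system: on points, the Steiner laws become the symmetries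
  \<open>block_commute\<close> and \<open>block_rotate\<close>.\<close>

lemma mult_eq_iff_block:
  assumes p: "p \<in> points n" and q: "q \<in> points n" and r: "r \<in> points n"
  shows "bose_point_mult n p q = Some r \<longleftrightarrow> block n p q r"
proof -
  obtain x i where p': "p = (x, i)"
    by (cases p)
  obtain y j where q': "q = (y, j)"
    by (cases q)
  obtain z k where r': "r = (z, k)"
    by (cases r)
  note xyz = fst_points[OF p, unfolded p' fst_conv] fst_points[OF q, unfolded q' fst_conv]
    fst_points[OF r, unfolded r' fst_conv]
  have 1: "x \<noteq> y \<and> [x + y = 2 * z] (mod int n) \<longleftrightarrow>
      x \<noteq> y \<and> (int t + 1) * (x + y) mod int n = z"
    using midpoint_iff xyz by simp
  have 2: "y \<noteq> z \<and> [y + z = 2 * x] (mod int n) \<longleftrightarrow> x \<noteq> y \<and> (2 * x - y) mod int n = z"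
    using reflect_iff[of z x y] midpoint_distinct[of y z x] midpoint_distinct[of z y x] xyz
    by (auto simp: add.commute)
  have 3: "z \<noteq> x \<and> [z + x = 2 * y] (mod int n) \<longleftrightarrow> x \<noteq> y \<and> (2 * y - x) mod int n = z"
    using reflect_iff[of z y x] midpoint_distinct[of z x y] xyz by auto
  have block: "block n p q r \<longleftrightarrow> x = y \<and> y = z \<and> i \<noteq> j \<and> j \<noteq> k \<and> i \<noteq> k \<or>
      j = i \<and> k = (i + 1) mod 3 \<and> x \<noteq> y \<and> (int t + 1) * (x + y) mod int n = z \<or>
      k = j \<and> i = (j + 1) mod 3 \<and> x \<noteq> y \<and> (2 * x - y) mod int n = z \<or>
      i = k \<and> j = (k + 1) mod 3 \<and> x \<noteq> y \<and> (2 * y - x) mod int n = z"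
    unfolding block_def vertical_def slanted_def p' q' r' fst_conv snd_conv
    using 1 2 3 by blast
  have "i = 0 \<or> i = 1 \<or> i = 2" "j = 0 \<or> j = 1 \<or> j = 2" "k = 0 \<or> k = 1 \<or> k = 2"
    using snd_points[OF p] snd_points[OF q] snd_points[OF r] by (simp_all add: p' q' r')
  then show ?thesis
    unfolding block using bose_point_mult_eq[of x i y j] p q
    by (elim disjE) (simp_all add: p' q' r' del: mult_minus_right)
qed

lemma mult_closed:
  assumes "p \<in> points n" "q \<in> points n" "bose_point_mult n p q = Some r"
  shows "r \<in> points n"
proof -
  obtain x i where p': "p = (x, i)"
    by (cases p)
  obtain y j where q': "q = (y, j)"
    by (cases q)
  have "i = 0 \<or> i = 1 \<or> i = 2" "j = 0 \<or> j = 1 \<or> j = 2"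
    using snd_points[OF assms(1)] snd_points[OF assms(2)] by (simp_all add: p' q')
  moreover have "0 \<le> z mod int n \<and> z mod int n < int n" for z
    using n by simp
  moreover have "0 \<le> x \<and> x < int n"
    using fst_points[OF assms(1)] by (simp add: p')
  ultimately show ?thesis
    using assms bose_point_mult_eq[of x i y j]
    by (elim disjE) (auto simp: p' q' points_def split: if_splits)
qed

lemma mult_eq_None_iff:
  assumes "p \<in> points n" "q \<in> points n"
  shows "bose_point_mult n p q = None \<longleftrightarrow> p = q"
  using assms by (cases p; cases q) (simp add: bose_point_mult_eq)

lemma mult_commute:
  assumes p: "p \<in> points n" and q: "q \<in> points n"
  shows "bose_point_mult n p q = bose_point_mult n q p"
proof (cases "bose_point_mult n p q")
  case None
  then show ?thesis
    using mult_eq_None_iff p q by metis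
next
  case (Some r)
  then have "block n q p r"
    using mult_eq_iff_block[OF p q] mult_closed[OF p q] block_commute by blast
  then show ?thesis
    using Some mult_eq_iff_block[OF q p mult_closed[OF p q Some]] by simp
qed

lemma mult_mult_point:
  assumes p: "p \<in> points n" and q: "q \<in> points n" and r: "bose_point_mult n p q = Some r"
  shows "bose_point_mult n p r = Some q"
proof -
  have "block n p q r" "r \<in> points n"
    using mult_eq_iff_block[OF p q] mult_closed[OF p q] r by blast+
  then have "block n p r q"
    using block_commute block_rotate by blast
  then show ?thesis
    using mult_eq_iff_block[OF p \<open>r \<in> points n\<close> q] by blast
qed

lemma mult_bose_loop [simp]: "monoid.mult (bose_loop n) = bose_mult n"
  by (simp add: bose_loop_def)

lemma one_bose_loop [simp]: "monoid.one (bose_loop n) = None"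
  by (simp add: bose_loop_def)

lemma carrier_bose_loop: "carrier (bose_loop n) = insert None (Some ` points n)"
proof -
  have "{0..(2::int)} = {0, 1, 2}"
    by auto
  then show ?thesis
    by (auto simp: bose_loop_def residue_ring_def points_def)
qed

sublocale S: steiner_loop "bose_loop n"
  rewrites "monoid.mult (bose_loop n) = bose_mult n" and "monoid.one (bose_loop n) = None"
proof -
  have cl: "bose_mult n u v \<in> carrier (bose_loop n)"
    if uv: "u \<in> carrier (bose_loop n)" "v \<in> carrier (bose_loop n)" for u v
  proof (cases "u = None \<or> v = None")
    case True
    then show ?thesis
      using uv by (cases u; cases v) auto
  next
    case False
    then obtain p q where pq: "u = Some p" "v = Some q" "p \<in> points n" "q \<in> points n"
      using uv by (auto simp: carrier_bose_loop)
    then show ?thesis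
      using mult_closed[OF pq(3,4)]
      by (cases "bose_point_mult n p q") (simp_all add: carrier_bose_loop image_iff)
  qed
  have com: "bose_mult n u v = bose_mult n v u"
    if "u \<in> carrier (bose_loop n)" "v \<in> carrier (bose_loop n)" for u v
    using that mult_commute by (cases u; cases v) (auto simp: carrier_bose_loop)
  have inv: "bose_mult n u (bose_mult n u v) = v"
    if uv: "u \<in> carrier (bose_loop n)" "v \<in> carrier (bose_loop n)" for u v
  proof (cases "u = None \<or> v = None")
    case True
    then show ?thesis
      using uv mult_eq_None_iff by (cases u; cases v) (auto simp: carrier_bose_loop)
  next
    case False
    then obtain p q where pq: "u = Some p" "v = Some q" "p \<in> points n" "q \<in> points n"
      using uv by (auto simp: carrier_bose_loop)
    then show ?thesis
      using mult_eq_None_iff[OF pq(3,4)] mult_mult_point[OF pq(3,4)]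
      by (cases "bose_point_mult n p q") simp_all
  qed
  show "steiner_loop (bose_loop n)"
    using cl com inv by unfold_locales (simp_all add: carrier_bose_loop)
  show "monoid.mult (bose_loop n) = bose_mult n" "monoid.one (bose_loop n) = None"
    by simp_all
qed

section \<open>Failure of the Moufang identity\<close>

text \<open>With \<open>x = (0,0)\<close>, \<open>y = (0,1)\<close>, \<open>z = (1,0)\<close> the
  product \<open>((xy)x)z\<close> is \<open>(-1,0)\<close>, whereas \<open>x(y(xz))\<close> is
  \<open>(0,0)\<close> times a point of level 2, which never has level 0.\<close>

lemma not_moufang: "\<not> moufang_loop (bose_loop n)"
proof
  assume "moufang_loop (bose_loop n)"
  then interpret M: moufang_loop "bose_loop n" .
  have in_points: "(0, i) \<in> points n" "(z mod int n, i) \<in> points n"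
    if "i = 0 \<or> i = 1 \<or> i = 2" for i z
    using n t that by (auto simp: points_def)
  have "(1, 0) \<in> points n"
    using n t by (auto simp: points_def)
  note in_points = this in_points
  have nz: "(int t + 1) mod int n \<noteq> 0" "- 1 mod int n \<noteq> 0"
    using n t by (auto simp: zmod_minus1)
  \<comment> \<open>\<open>w\<close> represents 1/4, the first coordinate of \<open>y(xz)\<close>,
    where \<open>xz = (1/2,1)\<close>.\<close>
  define w where "w = (int t + 1) * (0 + (int t + 1) mod int n)"
  have "bose_point_mult n (0, 0) (0, 1) = Some (0, 2)" "bose_point_mult n (0, 2) (0, 0) = Some (0, 1)"
    "bose_point_mult n (0, 1) (1, 0) = Some (- 1 mod int n, 0)"
    "bose_point_mult n (0, 0) (1, 0) = Some ((int t + 1) mod int n, 1)"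
    by (simp_all add: bose_point_mult_eq in_points)
  moreover have "bose_point_mult n (0, 1) ((int t + 1) mod int n, 1) = Some (w mod int n, 2)"
    unfolding w_def using nz by (subst bose_point_mult_eq) (simp_all add: in_points)
  moreover have "bose_point_mult n (0, 0) (w mod int n, 2) \<noteq> Some (- 1 mod int n, 0)"
    by (subst bose_point_mult_eq) (auto intro: in_points)
  moreover have "Some (0, 0) \<in> carrier (bose_loop n)" "Some (0, 1) \<in> carrier (bose_loop n)"
    "Some (1, 0) \<in> carrier (bose_loop n)"
    using in_points by (auto simp: carrier_bose_loop)
  ultimately show False
    using M.moufang[of "Some (0, 0)" "Some (0, 1)" "Some (1, 0)"] by simp
qed

section \<open>Associating triples when 7 is invertible\<close>

lemma mult_distinct:
  assumes p: "p \<in> points n" and q: "q \<in> points n" and r: "bose_point_mult n p q = Some r"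
  shows "p \<noteq> q" "r \<noteq> p" "r \<noteq> q"
proof -
  show "p \<noteq> q"
    using mult_eq_None_iff[OF p q] r by auto
  show "r \<noteq> p"
    using mult_mult_point[OF p q r] mult_eq_None_iff[OF p p] by auto
  have "bose_point_mult n q p = Some r"
    using mult_commute[OF p q] r by simp
  from mult_mult_point[OF q p this] show "r \<noteq> q"
    using mult_eq_None_iff[OF q q] by auto
qed

text \<open>Otherwise \<open>a\<close>, \<open>b\<close>, \<open>c\<close>, \<open>d = ab\<close>,
  \<open>e = bc\<close> and the common product \<open>f\<close> would form a Pasch configuration,
  which \<open>no_pasch\<close> excludes.\<close>

lemma associative_degenerate:
  assumes "coprime 7 (int n)"
    and a: "a \<in> points n" and b: "b \<in> points n" and c: "c \<in> points n"
    and neq: "a \<noteq> b" "b \<noteq> c" "a \<noteq> c"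
    and assoc: "bose_mult n (bose_mult n (Some a) (Some b)) (Some c) =
      bose_mult n (Some a) (bose_mult n (Some b) (Some c))"
  shows "bose_point_mult n a b = Some c"
proof (rule ccontr)
  assume ab_neq: "bose_point_mult n a b \<noteq> Some c"
  obtain d where d: "bose_point_mult n a b = Some d"
    using mult_eq_None_iff[OF a b] neq by auto
  obtain e where e: "bose_point_mult n b c = Some e"
    using mult_eq_None_iff[OF b c] neq by auto
  have dp: "d \<in> points n" and ep: "e \<in> points n"
    using mult_closed d e a b c by blast+
  have "d \<noteq> c"
    using ab_neq d by auto
  then obtain f where f: "bose_point_mult n d c = Some f"
    using mult_eq_None_iff[OF dp c] by auto
  then have f': "bose_point_mult n a e = Some f"
    using assoc d e by simp
  have fp: "f \<in> points n"
    using mult_closed[OF dp c f] .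
  have d': "bose_point_mult n b a = Some d"
    using d mult_commute[OF a b] by simp
  have da: "bose_point_mult n d a = Some b" and db: "bose_point_mult n d b = Some a"
    using mult_mult_point[OF a b d] mult_mult_point[OF b a d'] mult_commute dp a b by auto
  \<comment> \<open>Cancellation separates the points: \<open>bd = a\<close> and
    \<open>be = c\<close>, so \<open>d = e\<close> would give \<open>a = c\<close>; likewise
    \<open>df = c\<close>, \<open>da = b\<close> and \<open>db = a\<close> separate \<open>f\<close>
    from \<open>a\<close> and \<open>b\<close>.\<close>
  have "d \<noteq> e"
    using mult_mult_point[OF b a d'] mult_mult_point[OF b c e] neq by auto
  moreover have "f \<noteq> a"
    using mult_mult_point[OF dp c f] da neq by auto
  moreover have "f \<noteq> b"
    using mult_mult_point[OF dp c f] db neq by auto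
  ultimately have D: "distinct [a, b, c, d, e, f]"
    using neq \<open>d \<noteq> c\<close> mult_distinct[OF a b d] mult_distinct[OF b c e] mult_distinct[OF dp c f]
      mult_distinct[OF a ep f'] by auto
  have B: "block n a b d" "block n b c e" "block n d c f" "block n a e f"
    using mult_eq_iff_block a b c dp ep fp d e f f' by blast+
  have "{a, b, c, d, e, f} \<subseteq> points n"
    using a b c dp ep fp by simp
  then show False
    using no_pasch[OF odd_n assms(1) _ D B] by simp
qed

text \<open>In every case the generators lie in \<open>{1, p, q, pq}\<close> for two of them: either
  one is the identity, or two coincide, or \<open>c = ab\<close> by
  \<open>associative_degenerate\<close>.\<close>

lemma associative_imp_group:
  assumes "coprime 7 (int n)"
    and a: "a \<in> carrier (bose_loop n)" and b: "b \<in> carrier (bose_loop n)" and c: "c \<in> carrier (bose_loop n)"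
    and assoc: "bose_mult n (bose_mult n a b) c = bose_mult n a (bose_mult n b c)"
  shows "group (bose_loop n\<lparr>carrier := loop_generate (bose_loop n) {a, b, c}\<rparr>)"
proof -
  consider "a = None" | "b = None" | "c = None" | "a = b" | "b = c" | "a = c" |
    a' b' c' where "a = Some a'" "b = Some b'" "c = Some c'" "a' \<noteq> b'" "b' \<noteq> c'" "a' \<noteq> c'"
    by (metis not_None_eq)
  then show ?thesis
  proof cases
    case 1
    then show ?thesis using S.group_generate_diassociative[OF b c] by simp
  next
    case 2
    then show ?thesis using S.group_generate_diassociative[OF a c] by simp
  next
    case 3
    then show ?thesis using S.group_generate_diassociative[OF a b] by simp
  next
    case 4
    then show ?thesis using S.group_generate_diassociative[OF a c] by simp
  next
    case 5
    then show ?thesis using S.group_generate_diassociative[OF a b] by simp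
  next
    case 6
    then show ?thesis using S.group_generate_diassociative[OF a b] by simp
  next
    case 7
    then have "bose_mult n a b = c"
      using associative_degenerate[OF assms(1), of a' b' c'] a b c assoc by (auto simp: carrier_bose_loop)
    then show ?thesis using S.group_generate_diassociative[OF a b] by simp
  qed
qed

section \<open>An associating triple that generates no group when 7 divides \<open>n\<close>\<close>

text \<open>The witness solves the equations \<open>u = 2v\<close>, \<open>v = 2w\<close>, \<open>w = 2u\<close> of the only possible Pasch
  configuration: \<open>u = 4m\<close>, \<open>v = 2m\<close>, \<open>w = m\<close> with \<open>7m = 0\<close>.\<close>
lemma not_moufang_property:
  assumes "7 dvd int n"
  shows "\<not> moufang_property (bose_loop n)"
proof
  assume mp: "moufang_property (bose_loop n)"
  obtain m where m: "int n = 7 * m"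
    using assms by auto
  then have m_pos: "m > 0"
    using n by linarith
  let ?a = "(0, 0) :: int \<times> int" and ?b = "(0, 1) :: int \<times> int" and ?c = "(m, 2) :: int \<times> int"
  have in_points: "(k * m, i) \<in> points n" if "0 \<le> k" "k < 7" "i = 0 \<or> i = 1 \<or> i = 2" for k i
    using that m m_pos by (auto simp: points_def)
  note pts = in_points[of 0 0, simplified] in_points[of 0 1, simplified] in_points[of 0 2, simplified]
    in_points[of 1 2, simplified] in_points[of 2 1, simplified] in_points[of 4 0, simplified]
    in_points[of 3 0, simplified] in_points[of 6 2, simplified]
  \<comment> \<open>Modulo \<open>n\<close> these say that \<open>4 * m\<close> is half of
    \<open>m\<close>, and that \<open>6 * m\<close> and \<open>3 * m\<close> are the negatives of
    \<open>m\<close> and \<open>4 * m\<close>.\<close>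
  have cong: "[8 * m = m] (mod int n)" "[7 * m = 0] (mod int n)"
    by (simp_all add: m cong_iff_dvd_diff)
  have ab: "bose_point_mult n ?a ?b = Some (0, 2)" and ba: "bose_point_mult n ?b (0, 2) = Some ?a"
    and bc: "bose_point_mult n ?b ?c = Some (2 * m, 1)"
    and abc: "bose_point_mult n (0, 2) ?c = Some (4 * m, 0)"
    and abc': "bose_point_mult n ?a (2 * m, 1) = Some (4 * m, 0)"
    and b_abc: "bose_point_mult n ?b (4 * m, 0) = Some (3 * m, 0)"
    and ac: "bose_point_mult n ?a ?c = Some (6 * m, 2)"
    using m_pos cong pts
    by (simp_all add: mult_eq_iff_block block_def vertical_def slanted_def cong_sym_eq)
  have car: "Some ?a \<in> carrier (bose_loop n)" "Some ?b \<in> carrier (bose_loop n)"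
    "Some ?c \<in> carrier (bose_loop n)"
    using pts by (simp_all add: carrier_bose_loop)
  let ?G = "loop_generate (bose_loop n) {Some ?a, Some ?b, Some ?c}"
  have "associator (bose_loop n) (Some ?a) (Some ?b) (Some ?c) = None"
    using loop.associator_eq_one_iff[OF S.loop car] ab bc abc abc' by simp
  then have "group (bose_loop n\<lparr>carrier := ?G\<rparr>)"
    using mp car unfolding moufang_property_def by simp
  then interpret G: group "bose_loop n\<lparr>carrier := ?G\<rparr>" .
  have sub: "\<And>x y. x \<in> ?G \<Longrightarrow> y \<in> ?G \<Longrightarrow> bose_mult n x y \<in> ?G"
    using S.subloop_generate[of "{Some ?a, Some ?b, Some ?c}"] car by (simp add: S.subloop_iff)
  have "Some ?a \<in> ?G" "Some ?b \<in> ?G" "Some ?c \<in> ?G"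
    using S.generate_subset[of "{Some ?a, Some ?b, Some ?c}"] by auto
  moreover have "Some (0, 2) \<in> ?G"
    using sub[of "Some ?a" "Some ?b"] ab calculation by simp
  \<comment> \<open>The triple \<open>b\<close>, \<open>ab\<close>, \<open>c\<close> betrays
    non-associativity: \<open>b(ab) = a\<close> makes the left side \<open>ac = (6m,2)\<close>,
    while the right side is \<open>b(4m,0) = (3m,0)\<close>, on another level.\<close>
  ultimately have "bose_mult n (bose_mult n (Some ?b) (Some (0, 2))) (Some ?c) =
      bose_mult n (Some ?b) (bose_mult n (Some (0, 2)) (Some ?c))"
    using G.m_assoc[of "Some ?b" "Some (0, 2)" "Some ?c"] by simp
  then show False
    using ba abc b_abc ac by simp
qed

section \<open>Invertibility of 7 and the equivalence\<close>

text \<open>\<open>res_units_eq\<close> describes units as representatives strictly between 0 and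
  \<open>n\<close>, so 7 has to be reduced (it may exceed \<open>n\<close>) and its residue shown to
  be nonzero.\<close>

lemma units_iff: "7 mod int n \<in> Units (residue_ring (int n)) \<longleftrightarrow> coprime 7 (int n)"
proof -
  have "7 mod int n \<noteq> 0" if "coprime 7 (int n)"
  proof
    assume "7 mod int n = 0"
    then have "int n dvd 1"
      using that coprime_common_divisor[of 7 "int n" "int n"] by auto
    then show False
      using n t by auto
  qed
  moreover have "0 \<le> 7 mod int n" "7 mod int n < int n"
    using n by simp_all
  moreover have "coprime (7 mod int n) (int n) \<longleftrightarrow> coprime 7 (int n)"
    using n by (intro coprime_mod_left_iff) simp
  ultimately show ?thesis
    by (auto simp: Z.res_units_eq)
qed

end

theorem theorem3:
  fixes n t :: nat
  assumes "n = 2 * t + 1" and "t \<ge> 1"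
  shows "moufang_property (bose_loop n) \<longleftrightarrow> 7 mod int n \<in> Units (residue_ring (int n))"
proof -
  interpret bose n t
    using assms by unfold_locales
  have "moufang_property (bose_loop n)" if "coprime 7 (int n)"
    unfolding moufang_property_def
    using S.loop not_moufang loop.associator_eq_one_iff[OF S.loop] associative_imp_group[OF that]
    by simp
  moreover have "7 dvd int n" if "\<not> coprime 7 (int n)"
    using that prime_imp_coprime[of "7 :: int" "int n"] by auto
  ultimately show ?thesis
    using units_iff not_moufang_property by blast
qed

end
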